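(* Consider an asynchronous system of $n\ge 5f+1$ replicas $p_0,\dots,p_{n-1}$, at most $f$ of which may be Byzantine. Then the MBC protocol (defined in the context) is a (Byzantine) reliable broadcast protocol, i.e. it satisfies: (Validity) if a correct replica $p$ broadcasts a message $m$, then $p$ eventually delivers $m$; (Agreement) if some correct replica delivers a message $m$, then every correct replica eventually delivers $m$; (Integrity) for any message $m$, every correct replica delivers $m$ at most once; moreover, if the sender is correct, then $m$ was previously broadcast by the sender.
   Context: System model. There are $n$ replicas, at most $f$ of which may exhibit arbitrary behavior (Byzantine failures); the others are correct. The system is purely asynchronous: no timing assumptions are made on message processing or transmission delays. In reliable broadcast, a sender $p_{sender}$ (one of the replicas) broadcasts a message to all other replicas in the group. Tools. An $(k,n)$ maximum distance separable (MDS) erasure coding scheme encodes $k$ data blocks into $n\ge k$ coded blocks such that all blocks can be recovered from any $k$ of the coded blocks by a decode algorithm. A Merkle tree is built, using a collision-resistant hash function, over $n$ blocks $l_0,\dots,l_{n-1}$; $h$ denotes its root and $b_j$ its $j$-th branch. A message carrying $(h,b_j,l_j)$ is valid if $b_j$ is a valid Merkle tree branch for the Merkle tree root $h$ and the data block $l_j$. The MBC protocol (code for replica $p_i$). 1. Upon input $m$ (if $p_{sender}=p_i$): let $l_j$ be the $j$-th block of the $(n-2f,n)$ erasure coding scheme applied to $m$, and let $h$ be the root of the Merkle tree for the blocks $l_0,\dots,l_{n-1}$; send $\mathsf{init}(h,b_j,l_j)$ to each $p_j$, where $b_j$ is the $j$-th Merkle tree branch. 2. Upon receiving $\mathsf{init}(h,b_i,l_i)$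 from $p_{sender}$: broadcast $\mathsf{witness}(h,b_i,l_i)$ to all replicas. 3. Upon receiving $n-2f$ valid messages $\mathsf{witness}(h,b_j,l_j)$: interpolate all blocks $\{l'_j\}$ from the $n-2f$ blocks and recompute the Merkle root $h'$; if $h'\neq h$, abort. If $\mathsf{witness}(h,b_i,l_i)$ has not been sent, broadcast $\mathsf{witness}(h,b_i,l_i)$. 4. Upon receiving $n-f$ valid messages $\mathsf{witness}(h,b_j,l_j)$: decode $m$ from any $n-2f$ of the blocks $l_j$ and deliver $m$. *)

theory Defs
  imports Main
begin

section \<open>Erasure codes\<close>

text \<open>
  Data blocks and coded blocks share one alphabet. The argument of the decoder is a partial map
  from block indices to blocks. If these blocks are not part of a codeword, the decoder may
  return any \<open>k\<close> data blocks.
\<close>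

definition mds_code ::
  "nat \<Rightarrow> nat \<Rightarrow> ('b list \<Rightarrow> 'b list) \<Rightarrow> ((nat \<Rightarrow> 'b option) \<Rightarrow> 'b list) \<Rightarrow> bool" where
  "mds_code k n enc dec \<longleftrightarrow>
     k \<le> n \<and>
     (\<forall>d. length d = k \<longrightarrow> length (enc d) = n) \<and>
     (\<forall>c. dom c \<subseteq> {..<n} \<and> card (dom c) = k \<longrightarrow> length (dec c) = k) \<and>
     (\<forall>d K. length d = k \<and> K \<subseteq> {..<n} \<and> card K = k \<longrightarrow>
        dec (\<lambda>j. if j \<in> K then Some (enc d ! j) else None) = d)"


section \<open>Merkle trees\<close>

datatype ('b, 'h) hash_input = Leaf 'b | Node 'h 'h

text \<open>
  A tree over at least two blocks is split after the first \<open>length xs div 2\<close> blocks.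
  \<open>merkle_inputs\<close> is the set of values that are hashed when the root is computed.
\<close>

function merkle_root :: "(('b, 'h) hash_input \<Rightarrow> 'h) \<Rightarrow> 'b list \<Rightarrow> 'h" where
  "merkle_root H xs =
     (if length xs \<le> 1 then H (Leaf (hd xs))
      else H (Node (merkle_root H (take (length xs div 2) xs))
                   (merkle_root H (drop (length xs div 2) xs))))"
  by pat_completeness auto
termination by (relation "measure (\<lambda>(H, xs). length xs)") auto

declare merkle_root.simps [simp del]

function merkle_inputs ::
  "(('b, 'h) hash_input \<Rightarrow> 'h) \<Rightarrow> 'b list \<Rightarrow> ('b, 'h) hash_input set" where
  "merkle_inputs H xs =
     (if length xs \<le> 1 then {Leaf (hd xs)}
      else insert (Node (merkle_root H (take (length xs div 2) xs))
                        (merkle_root H (drop (length xs div 2) xs)))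
             (merkle_inputs H (take (length xs div 2) xs) \<union>
              merkle_inputs H (drop (length xs div 2) xs)))"
  by pat_completeness auto
termination by (relation "measure (\<lambda>(H, xs). length xs)") auto

declare merkle_inputs.simps [simp del]

text \<open>The branch of block \<open>j\<close> lists the sibling hashes on its path, starting below the root.\<close>

function merkle_branch :: "(('b, 'h) hash_input \<Rightarrow> 'h) \<Rightarrow> 'b list \<Rightarrow> nat \<Rightarrow> 'h list" where
  "merkle_branch H xs j =
     (if length xs \<le> 1 then []
      else if j < length xs div 2
        then merkle_root H (drop (length xs div 2) xs)
               # merkle_branch H (take (length xs div 2) xs) j
        else merkle_root H (take (length xs div 2) xs)
               # merkle_branch H (drop (length xs div 2) xs) (j - length xs div 2))"
  by pat_completeness auto
termination by (relation "measure (\<lambda>(H, xs, j). length xs)") auto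

declare merkle_branch.simps [simp del]

text \<open>
  The root recomputed from block \<open>l\<close> at position \<open>j\<close> of a tree over \<open>n\<close> blocks and a claimed
  branch; \<open>None\<close> if the branch does not have the length of the path. \<open>branch_inputs\<close> collects
  the values hashed on the way.
\<close>

fun branch_root ::
  "(('b, 'h) hash_input \<Rightarrow> 'h) \<Rightarrow> nat \<Rightarrow> nat \<Rightarrow> 'h list \<Rightarrow> 'b \<Rightarrow> 'h option" where
  "branch_root H n j [] l = (if n \<le> 1 then Some (H (Leaf l)) else None)"
| "branch_root H n j (s # bs) l =
     (if n \<le> 1 then None
      else if j < n div 2
        then map_option (\<lambda>r. H (Node r s)) (branch_root H (n div 2) j bs l)
        else map_option (\<lambda>r. H (Node s r)) (branch_root H (n - n div 2) (j - n div 2) bs l))"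

fun branch_inputs ::
  "(('b, 'h) hash_input \<Rightarrow> 'h) \<Rightarrow> nat \<Rightarrow> nat \<Rightarrow> 'h list \<Rightarrow> 'b \<Rightarrow> ('b, 'h) hash_input set" where
  "branch_inputs H n j [] l = (if n \<le> 1 then {Leaf l} else {})"
| "branch_inputs H n j (s # bs) l =
     (if n \<le> 1 then {}
      else if j < n div 2
        then (\<lambda>r. Node r s) ` set_option (branch_root H (n div 2) j bs l)
               \<union> branch_inputs H (n div 2) j bs l
        else (\<lambda>r. Node s r) ` set_option (branch_root H (n - n div 2) (j - n div 2) bs l)
               \<union> branch_inputs H (n - n div 2) (j - n div 2) bs l)"

definition valid_branch ::
  "(('b, 'h) hash_input \<Rightarrow> 'h) \<Rightarrow> nat \<Rightarrow> 'h \<Rightarrow> nat \<Rightarrow> 'h list \<Rightarrow> 'b \<Rightarrow> bool" where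
  "valid_branch H n h j b l \<longleftrightarrow> branch_root H n j b l = Some h"


section \<open>Reliable broadcast\<close>

text \<open>
  \<open>bc t p m\<close>: replica \<open>p\<close> broadcasts \<open>m\<close> in step \<open>t\<close> of the execution;
  \<open>dl t p m\<close>: replica \<open>p\<close> delivers \<open>m\<close> in step \<open>t\<close>.
\<close>

definition rb_validity ::
  "nat set \<Rightarrow> (nat \<Rightarrow> nat \<Rightarrow> 'm \<Rightarrow> bool) \<Rightarrow> (nat \<Rightarrow> nat \<Rightarrow> 'm \<Rightarrow> bool) \<Rightarrow> bool" where
  "rb_validity correct bc dl \<longleftrightarrow>
     (\<forall>p\<in>correct. \<forall>m t. bc t p m \<longrightarrow> (\<exists>t'\<ge>t. dl t' p m))"

definition rb_agreement ::
  "nat set \<Rightarrow> (nat \<Rightarrow> nat \<Rightarrow> 'm \<Rightarrow> bool) \<Rightarrow> bool" where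
  "rb_agreement correct dl \<longleftrightarrow>
     (\<forall>p\<in>correct. \<forall>m t. dl t p m \<longrightarrow> (\<forall>q\<in>correct. \<exists>t'. dl t' q m))"

definition rb_integrity ::
  "nat set \<Rightarrow> nat \<Rightarrow> (nat \<Rightarrow> nat \<Rightarrow> 'm \<Rightarrow> bool) \<Rightarrow> (nat \<Rightarrow> nat \<Rightarrow> 'm \<Rightarrow> bool) \<Rightarrow> bool" where
  "rb_integrity correct sender bc dl \<longleftrightarrow>
     (\<forall>p\<in>correct. \<forall>m t t'. dl t p m \<and> dl t' p m \<longrightarrow> t = t') \<and>
     (sender \<in> correct \<longrightarrow>
        (\<forall>p\<in>correct. \<forall>m t. dl t p m \<longrightarrow> (\<exists>t'<t. bc t' sender m)))"

definition reliable_broadcast ::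
  "nat set \<Rightarrow> nat \<Rightarrow> (nat \<Rightarrow> nat \<Rightarrow> 'm \<Rightarrow> bool) \<Rightarrow> (nat \<Rightarrow> nat \<Rightarrow> 'm \<Rightarrow> bool) \<Rightarrow> bool" where
  "reliable_broadcast correct sender bc dl \<longleftrightarrow>
     rb_validity correct bc dl \<and> rb_agreement correct dl \<and> rb_integrity correct sender bc dl"


section \<open>The MBC protocol\<close>

datatype ('b, 'h) payload = Init 'h "'h list" 'b | Witness 'h "'h list" 'b

text \<open>
  \<open>wit_rcvd\<close> also records which replica the witness message came from.
  \<open>checked\<close> and \<open>delivered\<close> contain the roots for which the rules with threshold
  \<open>n - 2 * f\<close> and \<open>n - f\<close> have been executed; each of the two is executed at most once per root.
  \<open>hashed\<close> is a ghost variable: the values the replica has hashed so far.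
\<close>

record ('b, 'h) local_state =
  has_input :: bool
  got_init :: bool
  wit_sent :: "('h \<times> 'h list \<times> 'b) set"
  wit_rcvd :: "(nat \<times> 'h \<times> 'h list \<times> 'b) set"
  checked :: "'h set"
  delivered :: "'h set"
  aborted :: bool
  hashed :: "('b, 'h) hash_input set"

definition initial_local :: "('b, 'h) local_state" where
  "initial_local = \<lparr>has_input = False, got_init = False, wit_sent = {}, wit_rcvd = {},
     checked = {}, delivered = {}, aborted = False, hashed = {}\<rparr>"

text \<open>
  The network contains every triple \<open>(source, destination, payload)\<close> sent so far; nothing is
  removed, so that it may delay, reorder and duplicate messages.
\<close>

record ('b, 'h) config =
  local :: "nat \<Rightarrow> ('b, 'h) local_state"
  network :: "(nat \<times> nat \<times> ('b, 'h) payload) set"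

definition initial_config :: "('b, 'h) config" where
  "initial_config = \<lparr>local = (\<lambda>_. initial_local), network = {}\<rparr>"

text \<open>
  The last argument of \<open>Receive source destination payload d\<close> is the message, if any, that the
  destination delivers in this step.
\<close>

datatype ('b, 'h) action =
    Broadcast "'b list"
  | Receive nat nat "('b, 'h) payload" "'b list option"
  | Byzantine_Send nat nat "('b, 'h) payload"
  | Idle

locale mbc =
  fixes n f sender :: nat
    and byz :: "nat set"
    and H :: "('b, 'h) hash_input \<Rightarrow> 'h"
    and enc :: "'b list \<Rightarrow> 'b list"
    and dec :: "(nat \<Rightarrow> 'b option) \<Rightarrow> 'b list"
begin

definition correct :: "nat set" where
  "correct = {..<n} - byz"

text \<open>
  A witness message from replica \<open>j\<close> has to carry the \<open>j\<close>-th block. Thresholds count distinct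
  replicas.
\<close>

definition witnesses :: "('b, 'h) local_state \<Rightarrow> 'h \<Rightarrow> nat set" where
  "witnesses s h = {j. \<exists>b l. (j, h, b, l) \<in> wit_rcvd s \<and> valid_branch H n h j b l}"

definition selection :: "('b, 'h) local_state \<Rightarrow> 'h \<Rightarrow> (nat \<Rightarrow> 'b option) \<Rightarrow> bool" where
  "selection s h c \<longleftrightarrow>
     card (dom c) = n - 2 * f \<and>
     (\<forall>j l. c j = Some l \<longrightarrow> (\<exists>b. (j, h, b, l) \<in> wit_rcvd s \<and> valid_branch H n h j b l))"

text \<open>
  \<open>interpolate i h s s' W\<close>: replica \<open>i\<close> executes, where applicable, the rule with threshold
  \<open>n - 2 * f\<close> for root \<open>h\<close> and broadcasts the witness messages in \<open>W\<close>.
\<close>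

inductive interpolate ::
  "nat \<Rightarrow> 'h \<Rightarrow> ('b, 'h) local_state \<Rightarrow> ('b, 'h) local_state \<Rightarrow> ('h \<times> 'h list \<times> 'b) set \<Rightarrow> bool"
  for i h s where
  interpolate_skip:
    "h \<in> checked s \<or> card (witnesses s h) < n - 2 * f \<Longrightarrow> interpolate i h s s {}"
| interpolate_abort:
    "\<lbrakk>h \<notin> checked s; card (witnesses s h) \<ge> n - 2 * f; selection s h c; ls = enc (dec c);
      merkle_root H ls \<noteq> h\<rbrakk>
     \<Longrightarrow> interpolate i h s
          (s\<lparr>checked := insert h (checked s), hashed := hashed s \<union> merkle_inputs H ls,
             aborted := True\<rparr>) {}"
| interpolate_pass:
    "\<lbrakk>h \<notin> checked s; card (witnesses s h) \<ge> n - 2 * f; selection s h c; ls = enc (dec c);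
      merkle_root H ls = h; w = (h, merkle_branch H ls i, ls ! i)\<rbrakk>
     \<Longrightarrow> interpolate i h s
          (s\<lparr>checked := insert h (checked s), hashed := hashed s \<union> merkle_inputs H ls,
             wit_sent := insert w (wit_sent s)\<rparr>)
          (if w \<in> wit_sent s then {} else {w})"

text \<open>\<open>deliver h s s' d\<close>: the rule with threshold \<open>n - f\<close> for root \<open>h\<close>.\<close>

inductive deliver ::
  "'h \<Rightarrow> ('b, 'h) local_state \<Rightarrow> ('b, 'h) local_state \<Rightarrow> 'b list option \<Rightarrow> bool"
  for h s where
  deliver_skip:
    "aborted s \<or> h \<in> delivered s \<or> card (witnesses s h) < n - f \<Longrightarrow> deliver h s s None"
| deliver_now:
    "\<lbrakk>\<not> aborted s; h \<notin> delivered s; card (witnesses s h) \<ge> n - f; selection s h c\<rbrakk>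
     \<Longrightarrow> deliver h s (s\<lparr>delivered := insert h (delivered s)\<rparr>) (Some (dec c))"

text \<open>
  \<open>receive i s j p s' W d\<close>: replica \<open>i\<close> in state \<open>s\<close> receives \<open>p\<close> from replica \<open>j\<close>. An aborted
  replica no longer reacts, and only the first init message from the sender is answered.
\<close>

inductive receive ::
  "nat \<Rightarrow> ('b, 'h) local_state \<Rightarrow> nat \<Rightarrow> ('b, 'h) payload \<Rightarrow>
   ('b, 'h) local_state \<Rightarrow> ('h \<times> 'h list \<times> 'b) set \<Rightarrow> 'b list option \<Rightarrow> bool"
  for i s j where
  receive_aborted:
    "aborted s \<Longrightarrow> receive i s j p s {} None"
| receive_init_ignored:
    "\<lbrakk>\<not> aborted s; j \<noteq> sender \<or> got_init s\<rbrakk> \<Longrightarrow> receive i s j (Init h b l) s {} None"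
| receive_init:
    "\<lbrakk>\<not> aborted s; j = sender; \<not> got_init s\<rbrakk>
     \<Longrightarrow> receive i s j (Init h b l)
          (s\<lparr>got_init := True, wit_sent := insert (h, b, l) (wit_sent s)\<rparr>) {(h, b, l)} None"
| receive_witness:
    "\<lbrakk>\<not> aborted s;
      s1 = s\<lparr>wit_rcvd := insert (j, h, b, l) (wit_rcvd s),
             hashed := hashed s \<union> branch_inputs H n j b l\<rparr>;
      interpolate i h s1 s2 W; deliver h s2 s3 d\<rbrakk>
     \<Longrightarrow> receive i s j (Witness h b l) s3 W d"

inductive step ::
  "('b, 'h) config \<Rightarrow> ('b, 'h) action \<Rightarrow> ('b, 'h) config \<Rightarrow> bool"
  for C where
  step_broadcast:
    "\<lbrakk>sender \<in> correct; s = local C sender; \<not> has_input s; length m = n - 2 * f; ls = enc m\<rbrakk>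
     \<Longrightarrow> step C (Broadcast m)
          (C\<lparr>local := (local C)(sender :=
                s\<lparr>has_input := True, hashed := hashed s \<union> merkle_inputs H ls\<rparr>),
             network := network C \<union>
                {(sender, j, Init (merkle_root H ls) (merkle_branch H ls j) (ls ! j)) | j. j < n}\<rparr>)"
| step_receive:
    "\<lbrakk>i \<in> correct; (j, i, p) \<in> network C; receive i (local C i) j p s' W d\<rbrakk>
     \<Longrightarrow> step C (Receive j i p d)
          (C\<lparr>local := (local C)(i := s'),
             network := network C \<union>
                {(i, k, Witness h b l) | k h b l. k < n \<and> (h, b, l) \<in> W}\<rparr>)"
| step_byzantine:
    "\<lbrakk>j \<in> byz; i < n\<rbrakk>
     \<Longrightarrow> step C (Byzantine_Send j i p) (C\<lparr>network := insert (j, i, p) (network C)\<rparr>)"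
| step_idle:
    "step C Idle C"

text \<open>
  Channels between correct replicas are reliable. Nothing else is assumed about the schedule.
\<close>

definition execution ::
  "(nat \<Rightarrow> ('b, 'h) config) \<Rightarrow> (nat \<Rightarrow> ('b, 'h) action) \<Rightarrow> bool" where
  "execution C a \<longleftrightarrow>
     C 0 = initial_config \<and>
     (\<forall>t. step (C t) (a t) (C (Suc t))) \<and>
     (\<forall>t. \<forall>j\<in>correct. \<forall>i\<in>correct. \<forall>p. (j, i, p) \<in> network (C t) \<longrightarrow>
        (\<exists>t' d. a t' = Receive j i p d))"

text \<open>
  Collision resistance of \<open>H\<close>, in the form needed for a single execution: the correct replicas
  never hash two different values with the same hash. This is weaker than injectivity of \<open>H\<close>,
  which fails for hash functions with outputs of bounded length.
\<close>

definition collision_free :: "(nat \<Rightarrow> ('b, 'h) config) \<Rightarrow> bool" where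
  "collision_free C \<longleftrightarrow> inj_on H (\<Union>t. \<Union>i\<in>correct. hashed (local (C t) i))"

definition broadcasts :: "(nat \<Rightarrow> ('b, 'h) action) \<Rightarrow> nat \<Rightarrow> nat \<Rightarrow> 'b list \<Rightarrow> bool" where
  "broadcasts a t p m \<longleftrightarrow> p = sender \<and> a t = Broadcast m"

definition delivers :: "(nat \<Rightarrow> ('b, 'h) action) \<Rightarrow> nat \<Rightarrow> nat \<Rightarrow> 'b list \<Rightarrow> bool" where
  "delivers a t p m \<longleftrightarrow> (\<exists>j q. a t = Receive j p q (Some m))"

end

end

theory Submission
  imports Defs
begin

text \<open>
  A replica that sees \<open>n - 2 * f\<close> valid witness messages for a root \<open>h\<close> hears from at least
  \<open>n - 2 * f - b\<close> correct ones, where \<open>b\<close> is the number of Byzantine replicas. The first correct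
  replicas to send such a message were prompted by an init message, and a correct replica accepts
  one init message only. As \<open>2 * (n - 2 * f - b) > n - b\<close>, at most one root ever reaches this
  threshold in the whole execution. If one correct replica passes the root check, or if a correct
  sender computed the root, then collision freeness forces every block with a valid branch to be
  the corresponding block of one fixed codeword. Hence all correct replicas decode the same
  message, none aborts, each contributes a valid witness message, and all reach the threshold
  \<open>n - f\<close>.
\<close>

section \<open>Merkle branches\<close>

text \<open>Both recursions split at half the length, so the path rebuilds exactly the hashes of the
  tree. This makes the witness of a correct replica for its own block valid.\<close>

lemma branch_root_merkle_branch:
  assumes "length xs = n" "j < n"
  shows "branch_root H n j (merkle_branch H xs j) (xs ! j) = Some (merkle_root H xs)"
  using assms
proof (induction H xs j arbitrary: n rule: merkle_branch.induct)
  case (1 H xs j)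
  show ?case
  proof (cases "length xs \<le> 1")
    case True
    with 1 have "hd xs = xs ! j" by (cases xs) auto
    with True 1 show ?thesis
      by (simp add: merkle_branch.simps[of H xs] merkle_root.simps[of H xs])
  next
    case False
    then show ?thesis
      using 1 by (auto simp: merkle_branch.simps[of H xs] merkle_root.simps[of H xs])
  qed
qed

text \<open>Binding property of the tree. Descending from the root, equal hashes force equal
  \<open>Node\<close> inputs, hence equal roots of the subtree on the path, until the two
  \<open>Leaf\<close> inputs coincide. Injectivity is required only on the values hashed on either
  side, so that \<open>collision_free\<close> can supply it.\<close>

lemma branch_root_collision_free:
  fixes H :: "('b, 'h) hash_input \<Rightarrow> 'h"
  assumes "branch_root H n j b l = Some (merkle_root H xs)"
    and "length xs = n" "j < n"
    and "inj_on H (branch_inputs H n j b l \<union> merkle_inputs H xs)"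
  shows "l = xs ! j"
  using assms
proof (induction H n j b l arbitrary: xs rule: branch_root.induct)
  case (1 H n j l)
  then have "length xs = 1" "n = 1" "j = 0" by (auto split: if_splits)
  moreover from this obtain x where "xs = [x]" by (auto simp: length_Suc_conv)
  moreover from this have "merkle_root H xs = H (Leaf x)" "merkle_inputs H xs = {Leaf x}"
    by (simp_all add: merkle_root.simps[of H "[x]"] merkle_inputs.simps[of H "[x]"])
  ultimately have "Leaf l = Leaf x"
    using 1(1) inj_onD[OF 1(4), of "Leaf l" "Leaf x"] by simp
  then show ?case using \<open>xs = [x]\<close> \<open>j = 0\<close> by simp
next
  case (2 H n j s bs l)
  then have n: "\<not> n \<le> 1" by (auto split: if_splits)
  let ?T = "take (n div 2) xs" and ?D = "drop (n div 2) xs"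
  have root: "merkle_root H xs = H (Node (merkle_root H ?T) (merkle_root H ?D))"
    and inp: "merkle_inputs H xs = insert (Node (merkle_root H ?T) (merkle_root H ?D))
          (merkle_inputs H ?T \<union> merkle_inputs H ?D)"
    using n 2 by (auto simp: merkle_root.simps[of H xs] merkle_inputs.simps[of H xs])
  show ?case
  proof (cases "j < n div 2")
    case True
    obtain r where r: "branch_root H (n div 2) j bs l = Some r" "H (Node r s) = merkle_root H xs"
      using 2 n True by auto
    have "Node r s = (Node (merkle_root H ?T) (merkle_root H ?D) :: ('b, 'h) hash_input)"
      by (rule inj_onD[OF 2(6)]) (use r root inp n True in auto)
    then have "r = merkle_root H ?T" by simp
    moreover have "inj_on H (branch_inputs H (n div 2) j bs l \<union> merkle_inputs H ?T)"
      by (rule inj_on_subset[OF 2(6)]) (use inp n True in auto)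
    ultimately have "l = ?T ! j"
      using 2(1)[OF n True, of ?T] r 2 True by auto
    then show ?thesis using True by simp
  next
    case False
    obtain r where r: "branch_root H (n - n div 2) (j - n div 2) bs l = Some r"
        "H (Node s r) = merkle_root H xs"
      using 2 n False by auto
    have "Node s r = (Node (merkle_root H ?T) (merkle_root H ?D) :: ('b, 'h) hash_input)"
      by (rule inj_onD[OF 2(6)]) (use r root inp n False in auto)
    then have "r = merkle_root H ?D" by simp
    moreover have "inj_on H (branch_inputs H (n - n div 2) (j - n div 2) bs l \<union> merkle_inputs H ?D)"
      by (rule inj_on_subset[OF 2(6)]) (use inp n False in auto)
    ultimately have "l = ?D ! (j - n div 2)"
      using 2(2)[OF n False, of ?D] r 2 False by auto
    then show ?thesis using False 2 by auto
  qed
qed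


section \<open>Effect of a single step on the local states\<close>

context mbc
begin

section \<open>Witness counting and the invariant of a single replica\<close>

lemma witnesses_cong: "wit_rcvd s = wit_rcvd s' \<Longrightarrow> witnesses s = witnesses s'"
  by (auto simp: witnesses_def fun_eq_iff)

lemma selection_cong: "wit_rcvd s = wit_rcvd s' \<Longrightarrow> selection s = selection s'"
  by (auto simp: selection_def fun_eq_iff)

lemma selection_mono: "selection s h c \<Longrightarrow> wit_rcvd s \<subseteq> wit_rcvd s' \<Longrightarrow> selection s' h c"
  unfolding selection_def by blast

lemma selection_witnesses: "selection s h c \<Longrightarrow> dom c \<subseteq> witnesses s h"
  by (fastforce simp: selection_def witnesses_def)

text \<open>Lasting evidence of a passed root check: each conjunct survives growth of the state. The
  clause on \<open>hashed\<close> makes collision freeness applicable to the decoded codeword later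
  on.\<close>

definition verified :: "nat \<Rightarrow> ('b, 'h) local_state \<Rightarrow> 'h \<Rightarrow> (nat \<Rightarrow> 'b option) \<Rightarrow> bool" where
  "verified i s h c \<longleftrightarrow>
     selection s h c \<and> merkle_inputs H (enc (dec c)) \<subseteq> hashed s \<and>
     merkle_root H (enc (dec c)) = h \<and>
     (h, merkle_branch H (enc (dec c)) i, enc (dec c) ! i) \<in> wit_sent s"

definition refuted :: "('b, 'h) local_state \<Rightarrow> 'h \<Rightarrow> (nat \<Rightarrow> 'b option) \<Rightarrow> bool" where
  "refuted s h c \<longleftrightarrow> selection s h c \<and> merkle_root H (enc (dec c)) \<noteq> h"

text \<open>The threshold clauses say that a rule whose threshold is met has been executed. They
  hold between steps because receiving a witness runs both rules at once. An aborted replica no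
  longer reacts, so for it only the evidence behind the abort is kept.\<close>

definition local_inv :: "nat \<Rightarrow> ('b, 'h) local_state \<Rightarrow> bool" where
  "local_inv i s \<longleftrightarrow>
     (\<forall>j h b l. (j, h, b, l) \<in> wit_rcvd s \<longrightarrow> j < n \<and> branch_inputs H n j b l \<subseteq> hashed s) \<and>
     (if aborted s then \<exists>h c. refuted s h c
      else (\<forall>h\<in>checked s. \<exists>c. verified i s h c) \<and>
        (\<forall>h. n - 2 * f \<le> card (witnesses s h) \<longrightarrow> h \<in> checked s) \<and>
        (\<forall>h. n - f \<le> card (witnesses s h) \<longrightarrow> h \<in> delivered s))"

lemma verified_mono:
  "\<lbrakk>verified i s h c; wit_rcvd s \<subseteq> wit_rcvd s'; hashed s \<subseteq> hashed s'; wit_sent s \<subseteq> wit_sent s'\<rbrakk>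
   \<Longrightarrow> verified i s' h c"
  unfolding verified_def using selection_mono by blast

lemma refuted_mono: "\<lbrakk>refuted s h c; wit_rcvd s \<subseteq> wit_rcvd s'\<rbrakk> \<Longrightarrow> refuted s' h c"
  unfolding refuted_def using selection_mono by blast

text \<open>The bound keeps both truncated differences positive, so an empty witness set meets
  neither threshold.\<close>

lemma local_inv_initial: "2 * f < n \<Longrightarrow> local_inv i initial_local"
  by (auto simp: local_inv_def initial_local_def witnesses_def)

lemma local_inv_mono:
  assumes inv: "local_inv i s"
    and eq: "wit_rcvd s' = wit_rcvd s" "aborted s' = aborted s" "checked s' = checked s"
      "delivered s' = delivered s"
    and sub: "hashed s \<subseteq> hashed s'" "wit_sent s \<subseteq> wit_sent s'"
  shows "local_inv i s'"
proof -
  have "witnesses s' = witnesses s"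
    using eq by (intro witnesses_cong)
  moreover have "verified i s h c \<Longrightarrow> verified i s' h c" "refuted s h c \<Longrightarrow> refuted s' h c" for h c
    using verified_mono refuted_mono eq sub by blast+
  ultimately show ?thesis
    using inv eq sub unfolding local_inv_def by (simp split: if_splits) (meson subset_trans)+
qed

text \<open>Recording the message changes the witness set of \<open>h\<close> alone. For other roots
  the old invariant carries over, and for \<open>h\<close> the two rules that run next restore the
  threshold clauses.\<close>

lemma receive_witness_inv:
  assumes inv: "local_inv i s" and "j < n" and nab: "\<not> aborted s"
    and s1: "s1 = s\<lparr>wit_rcvd := insert (j, h, b, l) (wit_rcvd s),
             hashed := hashed s \<union> branch_inputs H n j b l\<rparr>"
    and int: "interpolate i h s1 s2 W" and del: "deliver h s2 s3 d"
  shows "local_inv i s3"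
proof -
  have W: "witnesses s1 h' = witnesses s h'" if "h' \<noteq> h" for h'
    using that unfolding witnesses_def s1 by auto
  have rcvd1: "j' < n \<and> branch_inputs H n j' b' l' \<subseteq> hashed s1"
    if "(j', h', b', l') \<in> wit_rcvd s1" for j' h' b' l'
  proof -
    have "(j', h', b', l') = (j, h, b, l) \<or> (j', h', b', l') \<in> wit_rcvd s"
      using that by (simp add: s1)
    moreover have "(j', h', b', l') \<in> wit_rcvd s \<Longrightarrow> j' < n \<and> branch_inputs H n j' b' l' \<subseteq> hashed s"
      using inv unfolding local_inv_def by blast
    ultimately show ?thesis using \<open>j < n\<close> by (auto simp: s1)
  qed
  have checked1: "\<exists>c. verified i s1 h' c" if h': "h' \<in> checked s1" for h'
  proof -
    obtain c where "verified i s h' c"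
      using h' inv nab unfolding local_inv_def s1 by auto
    then have "verified i s1 h' c" by (rule verified_mono) (auto simp: s1)
    then show ?thesis by blast
  qed
  have low1: "h' \<in> checked s1" if "n - 2 * f \<le> card (witnesses s1 h')" "h' \<noteq> h" for h'
    using that inv nab W[OF that(2)] unfolding local_inv_def by (simp add: s1)
  have high1: "h' \<in> delivered s1" if "n - f \<le> card (witnesses s1 h')" "h' \<noteq> h" for h'
    using that inv nab W[OF that(2)] unfolding local_inv_def by (simp add: s1)
  have nab1: "\<not> aborted s1" using nab by (simp add: s1)
  have r2: "wit_rcvd s2 = wit_rcvd s1" and d2: "delivered s2 = delivered s1"
    and h2: "hashed s1 \<subseteq> hashed s2" and ws2: "wit_sent s1 \<subseteq> wit_sent s2"
    using int by (auto elim: interpolate.cases)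
  have r3: "wit_rcvd s3 = wit_rcvd s2" and eq3: "checked s3 = checked s2"
    "aborted s3 = aborted s2" "wit_sent s3 = wit_sent s2" "hashed s3 = hashed s2"
    using del by (auto elim: deliver.cases)
  have w2: "witnesses s2 = witnesses s1" and w3: "witnesses s3 = witnesses s1"
    using r2 r3 witnesses_cong by metis+
  have sel2: "selection s2 = selection s1"
    using r2 selection_cong by metis
  \<comment> \<open>Without an abort, the delivery rule can be skipped only if \<open>h\<close> was
    delivered before or is below the threshold.\<close>
  have high3: "h' \<in> delivered s3" if "n - f \<le> card (witnesses s1 h')" "\<not> aborted s2" for h'
    using del
  proof cases
    case deliver_skip
    then show ?thesis using that high1[of h'] d2 w2 by (cases "h' = h") auto
  next
    case (deliver_now c)
    then show ?thesis using that high1[of h'] d2 w2 by (cases "h' = h") auto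
  qed
  have mid: "if aborted s2 then \<exists>h c. refuted s2 h c
      else (\<forall>h\<in>checked s2. \<exists>c. verified i s2 h c) \<and>
        (\<forall>h. n - 2 * f \<le> card (witnesses s1 h) \<longrightarrow> h \<in> checked s2)"
    using int
  proof cases
    case interpolate_skip
    have "h' \<in> checked s1" if "n - 2 * f \<le> card (witnesses s1 h')" for h'
      using that low1[of h'] interpolate_skip by (cases "h' = h") auto
    then show ?thesis using interpolate_skip nab1 checked1 by simp
  next
    case (interpolate_abort c ls)
    then have "refuted s2 h c" using sel2 by (simp add: refuted_def)
    then show ?thesis using interpolate_abort by auto
  next
    case (interpolate_pass c ls w)
    have "\<exists>c. verified i s2 h' c" if h': "h' \<in> checked s2" for h'
    proof (cases "h' = h")
      case True
      have "verified i s2 h c"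
        unfolding verified_def sel2 using interpolate_pass by auto
      then show ?thesis using True by blast
    next
      case False
      then obtain c' where "verified i s1 h' c'"
        using h' checked1 interpolate_pass by auto
      then have "verified i s2 h' c'"
        by (rule verified_mono) (use r2 h2 ws2 in auto)
      then show ?thesis by blast
    qed
    moreover have "\<not> aborted s2" using interpolate_pass nab1 by simp
    moreover have "h' \<in> checked s2" if "n - 2 * f \<le> card (witnesses s1 h')" for h'
      using low1[OF that] interpolate_pass by auto
    ultimately show ?thesis by simp
  qed
  have "verified i s2 h' c \<Longrightarrow> verified i s3 h' c" "refuted s2 h' c \<Longrightarrow> refuted s3 h' c" for h' c
    using verified_mono refuted_mono r3 eq3 by blast+
  moreover have "j' < n \<and> branch_inputs H n j' b' l' \<subseteq> hashed s3"
    if "(j', h', b', l') \<in> wit_rcvd s3" for j' h' b' l'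
    using rcvd1[of j' h' b' l'] that r2 r3 eq3 h2 by auto
  ultimately show ?thesis
    using mid high3 unfolding local_inv_def w3 eq3 by (cases "aborted s2") (simp_all, blast+)
qed

lemma local_inv_receive:
  assumes "receive i s j p s' W d" "local_inv i s" "j < n"
  shows "local_inv i s'"
  using assms(1)
proof cases
  case (receive_init h b l)
  then show ?thesis by (intro local_inv_mono[OF assms(2)]) auto
next
  case (receive_witness s1 b l h s2)
  show ?thesis
    by (rule receive_witness_inv[OF assms(2,3)]) (use receive_witness in auto)
qed (use assms in auto)

section \<open>Causes and effects of one receive step\<close>

lemma receive_mono:
  assumes "receive i s j p s' W d"
  shows "wit_rcvd s \<subseteq> wit_rcvd s'" "delivered s \<subseteq> delivered s'"
    "got_init s \<Longrightarrow> got_init s'" "has_input s' = has_input s"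
    "wit_sent s' = wit_sent s \<union> W"
  using assms by (auto elim!: receive.cases interpolate.cases deliver.cases split: if_splits)

text \<open>The case split behind the uniqueness of roots: a new witness comes from the first init
  message or from a quorum. The quorum is counted in \<open>s'\<close> because the incoming witness
  is recorded before the rule fires.\<close>

lemma receive_sent_origin:
  assumes "receive i s j p s' W d" "(h, b, l) \<in> W"
  shows "(p = Init h b l \<and> j = sender \<and> \<not> aborted s \<and> \<not> got_init s) \<or>
    n - 2 * f \<le> card (witnesses s' h)"
  using assms(1)
proof cases
  case (receive_witness s1 b' l' h' s2)
  from \<open>interpolate i h' s1 s2 W\<close> assms(2)
  have "h = h'" "n - 2 * f \<le> card (witnesses s1 h)" "wit_rcvd s2 = wit_rcvd s1"
    by (auto elim!: interpolate.cases split: if_splits)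
  moreover have "wit_rcvd s' = wit_rcvd s2"
    using receive_witness by (auto elim: deliver.cases)
  ultimately show ?thesis using witnesses_cong by metis
qed (use assms in auto)

lemma receive_init_accepted:
  assumes "receive i s sender (Init h b l) s' W d" "\<not> aborted s"
  shows "got_init s'" "\<not> got_init s \<Longrightarrow> (h, b, l) \<in> wit_sent s'"
  using assms by (auto elim: receive.cases)

lemma receive_got_init:
  assumes "receive i s j p s' W d" "got_init s'" "\<not> got_init s"
  shows "\<exists>h b l. p = Init h b l \<and> j = sender \<and> \<not> aborted s"
  using assms by (auto elim!: receive.cases interpolate.cases deliver.cases)

lemma receive_witness_recorded:
  assumes "receive i s j (Witness h b l) s' W d" "\<not> aborted s"
  shows "(j, h, b, l) \<in> wit_rcvd s'"
  using assms by (auto elim!: receive.cases interpolate.cases deliver.cases)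

lemma receive_wit_rcvd:
  assumes "receive i s j p s' W d" "(k, h, b, l) \<in> wit_rcvd s'"
  shows "(k, h, b, l) \<in> wit_rcvd s \<or> k = j \<and> p = Witness h b l"
  using assms by (auto elim!: receive.cases interpolate.cases deliver.cases)

lemma receive_delivered:
  assumes "receive i s j p s' W d" "h \<in> delivered s'" "h \<notin> delivered s"
  shows "\<exists>c. selection s' h c \<and> d = Some (dec c)"
  using assms(1)
proof cases
  case (receive_witness s1 b' l' h' s2)
  have "delivered s2 = delivered s"
    using receive_witness by (auto elim: interpolate.cases)
  with \<open>deliver h' s2 s' d\<close> assms(2,3) show ?thesis
  proof cases
    case (deliver_now c)
    have "selection s' = selection s2" by (rule selection_cong) (use deliver_now in auto)
    then show ?thesis using deliver_now assms \<open>delivered s2 = delivered s\<close> by auto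
  qed auto
qed (use assms in auto)

text \<open>Reads a delivery off the action, whereas \<open>receive_delivered\<close> starts from
  the change of the set \<open>delivered\<close>. Validity and agreement need the latter, integrity
  the former.\<close>

lemma receive_delivers:
  assumes "receive i s j p s' W (Some m)"
  shows "\<exists>h c. selection s' h c \<and> m = dec c \<and> h \<in> delivered s' \<and> h \<notin> delivered s \<and>
    \<not> aborted s' \<and> n - f \<le> card (witnesses s' h)"
  using assms(1)
proof cases
  case (receive_witness s1 b l h s2)
  have "delivered s2 = delivered s"
    using receive_witness by (auto elim: interpolate.cases)
  from \<open>deliver h s2 s' (Some m)\<close> show ?thesis
  proof cases
    case (deliver_now c)
    have "selection s' = selection s2" "witnesses s' = witnesses s2"
      by (rule selection_cong witnesses_cong; use deliver_now in simp)+
    then show ?thesis using deliver_now \<open>delivered s2 = delivered s\<close>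
      by (intro exI[of _ h] exI[of _ c]) auto
  qed
qed

end

section \<open>Executions\<close>

locale mbc_run = mbc n f sender byz H enc dec
  for n f sender :: nat
    and byz :: "nat set"
    and H :: "('b, 'h) hash_input \<Rightarrow> 'h"
    and enc :: "'b list \<Rightarrow> 'b list"
    and dec :: "(nat \<Rightarrow> 'b option) \<Rightarrow> 'b list" +
  fixes C :: "nat \<Rightarrow> ('b, 'h) config"
    and a :: "nat \<Rightarrow> ('b, 'h) action"
  assumes resilience: "5 * f + 1 \<le> n"
    and sender_less: "sender < n"
    and byz_subset: "byz \<subseteq> {..<n}"
    and card_byz: "card byz \<le> f"
    and mds: "mds_code (n - 2 * f) n enc dec"
    and run: "execution C a"
    and no_collision: "collision_free C"
begin

abbreviation L :: "nat \<Rightarrow> nat \<Rightarrow> ('b, 'h) local_state" where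
  "L t \<equiv> local (C t)"

abbreviation N :: "nat \<Rightarrow> (nat \<times> nat \<times> ('b, 'h) payload) set" where
  "N t \<equiv> network (C t)"

lemma step_at: "step (C t) (a t) (C (Suc t))"
  using run by (simp add: execution_def)

lemma initial_at: "C 0 = initial_config"
  using run by (simp add: execution_def)

lemma eventually_received:
  "\<lbrakk>j \<in> correct; i \<in> correct; (j, i, p) \<in> N t\<rbrakk> \<Longrightarrow> \<exists>t' d. a t' = Receive j i p d"
  using run by (auto simp: execution_def)

lemma finite_correct: "finite correct"
  by (simp add: correct_def)

lemma card_correct: "card correct = n - card byz"
  using byz_subset by (simp add: correct_def card_Diff_subset finite_subset)

lemma received_step:
  assumes "a t = Receive j i p d"
  obtains W where "i \<in> correct" "(j, i, p) \<in> N t" "receive i (L t i) j p (L (Suc t) i) W d"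
  using step_at[of t] assms by (auto elim!: step.cases)

lemma local_step_cases:
  assumes "i \<in> correct"
  obtains
    (same) "L (Suc t) i = L t i"
  | (input) X where "L (Suc t) i = (L t i)\<lparr>has_input := True, hashed := hashed (L t i) \<union> X\<rparr>"
  | (received) j p W d where "a t = Receive j i p d" "(j, i, p) \<in> N t"
      "receive i (L t i) j p (L (Suc t) i) W d"
  using step_at[of t]
proof cases
  case (step_broadcast s m ls)
  then show ?thesis using same input by (cases "i = sender") auto
next
  case (step_receive k j p s' W d)
  then show ?thesis using same received by (cases "i = k") auto
qed (use same in auto)

lemma network_step_cases:
  assumes "(j, i, p) \<in> N (Suc t)"
  obtains
    (old) "(j, i, p) \<in> N t"
  | (init) m where "a t = Broadcast m" "j = sender" "i < n" "length m = n - 2 * f"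
      "p = Init (merkle_root H (enc m)) (merkle_branch H (enc m) i) (enc m ! i)"
      "merkle_inputs H (enc m) \<subseteq> hashed (L (Suc t) sender)"
  | (witness) k q d W h b l where "j \<in> correct" "i < n"
      "receive j (L t j) k q (L (Suc t) j) W d" "p = Witness h b l" "(h, b, l) \<in> W"
  | (byz) "j \<in> byz" "i < n"
  using step_at[of t]
proof cases
  case (step_broadcast s m ls)
  then show ?thesis using assms old init by auto
next
  case (step_receive k j' p' s' W d)
  then show ?thesis using assms old witness by auto
next
  case (step_byzantine j' i' p')
  then show ?thesis using assms old byz by auto
next
  case step_idle
  then show ?thesis using assms old by auto
qed

section \<open>Monotonicity and bookkeeping along the execution\<close>

lemma broadcast_step:
  assumes "a t = Broadcast m"
  shows "sender \<in> correct" "\<not> has_input (L t sender)" "has_input (L (Suc t) sender)"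
    "length m = n - 2 * f" "merkle_inputs H (enc m) \<subseteq> hashed (L (Suc t) sender)"
    "j < n \<Longrightarrow> (sender, j, Init (merkle_root H (enc m)) (merkle_branch H (enc m) j) (enc m ! j))
       \<in> N (Suc t)"
  using step_at[of t] assms by (auto elim!: step.cases)

lemma network_mono: "t \<le> t' \<Longrightarrow> N t \<subseteq> N t'"
proof (rule lift_Suc_mono_le[of N])
  show "N t \<subseteq> N (Suc t)" for t
    using step_at[of t] by (auto elim!: step.cases)
qed

lemma local_step_mono:
  assumes "i \<in> correct"
  shows "wit_rcvd (L t i) \<subseteq> wit_rcvd (L (Suc t) i)"
    "delivered (L t i) \<subseteq> delivered (L (Suc t) i)"
    "got_init (L t i) \<le> got_init (L (Suc t) i)" "has_input (L t i) \<le> has_input (L (Suc t) i)"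
  using assms by (rule local_step_cases[of _ t]; auto dest: receive_mono)+

lemma local_mono:
  assumes "i \<in> correct" "t \<le> t'"
  shows "wit_rcvd (L t i) \<subseteq> wit_rcvd (L t' i)" "delivered (L t i) \<subseteq> delivered (L t' i)"
    "got_init (L t i) \<le> got_init (L t' i)" "has_input (L t i) \<le> has_input (L t' i)"
proof -
  have "wit_rcvd (L t i) \<subseteq> wit_rcvd (L t' i) \<and> delivered (L t i) \<subseteq> delivered (L t' i) \<and>
    got_init (L t i) \<le> got_init (L t' i) \<and> has_input (L t i) \<le> has_input (L t' i)"
    using assms(2)
  proof (induction rule: dec_induct)
    case (step k)
    then show ?case using local_step_mono[OF assms(1), of k] by (meson order_trans)
  qed simp
  then show "wit_rcvd (L t i) \<subseteq> wit_rcvd (L t' i)" "delivered (L t i) \<subseteq> delivered (L t' i)"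
    "got_init (L t i) \<le> got_init (L t' i)" "has_input (L t i) \<le> has_input (L t' i)"
    by blast+
qed

lemma network_less: "(j, i, p) \<in> N t \<Longrightarrow> j < n \<and> i < n"
proof (induction t arbitrary: j i p)
  case 0
  then show ?case by (simp add: initial_at initial_config_def)
next
  case (Suc t)
  from Suc.prems show ?case
    by (cases rule: network_step_cases)
      (use Suc.IH sender_less byz_subset in \<open>auto simp: correct_def\<close>)
qed

lemma local_inv: "i \<in> correct \<Longrightarrow> local_inv i (L t i)"
proof (induction t)
  case 0
  then show ?case using resilience
    by (auto simp: initial_at initial_config_def intro!: local_inv_initial)
next
  case (Suc t)
  from Suc.prems show ?case
  proof (cases rule: local_step_cases[of _ t])
    case (received j p W d)
    then show ?thesis using Suc network_less by (auto intro: local_inv_receive)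
  qed (use Suc in \<open>auto intro: local_inv_mono[OF Suc.IH]\<close>)
qed

text \<open>Byzantine steps only insert triples with a source in \<open>byz\<close>, so nobody can
  impersonate \<open>j\<close>. A witness left out of \<open>W\<close> as already sent is in the
  network already, so records and network stay in step.\<close>

lemma sent_iff_network:
  assumes "j \<in> correct"
  shows "(j, i, Witness h b l) \<in> N t \<longleftrightarrow> i < n \<and> (h, b, l) \<in> wit_sent (L t j)"
proof (induction t)
  case 0
  then show ?case by (simp add: initial_at initial_config_def initial_local_def)
next
  case (Suc t)
  have "j \<notin> byz" using assms by (simp add: correct_def)
  from step_at[of t] show ?case
  proof cases
    case (step_receive k j' p' s' W d)
    then show ?thesis using Suc receive_mono(5)[of k "L t k" j' p' s' W d]
      by (cases "k = j") auto
  qed (use Suc \<open>j \<notin> byz\<close> in \<open>auto\<close>)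
qed

lemma rcvd_sent:
  assumes "i \<in> correct" "(j, h, b, l) \<in> wit_rcvd (L t i)"
  shows "\<exists>t'<t. (j, i, Witness h b l) \<in> N t'"
  using assms(2)
proof (induction t)
  case 0
  then show ?case by (simp add: initial_at initial_config_def initial_local_def)
next
  case (Suc t)
  from assms(1) show ?case
  proof (cases rule: local_step_cases[of _ t])
    case (received j' p W d)
    then show ?thesis using Suc receive_wit_rcvd[OF received(3)] less_Suc_eq by blast
  qed (use Suc less_Suc_eq in auto)
qed

text \<open>A message must be in the network before it is received. The shift from
  \<open>Suc t\<close> to \<open>t\<close> is what makes the induction over time in
  \<open>sent_root\<close> work.\<close>

lemma witness_sent:
  assumes "i \<in> correct" "j \<in> correct" "j \<in> witnesses (L (Suc t) i) h"
  shows "\<exists>b l. (h, b, l) \<in> wit_sent (L t j) \<and> valid_branch H n h j b l"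
proof -
  obtain b l where bl: "(j, h, b, l) \<in> wit_rcvd (L (Suc t) i)" "valid_branch H n h j b l"
    using assms(3) by (auto simp: witnesses_def)
  then obtain t' where "t' \<le> t" "(j, i, Witness h b l) \<in> N t'"
    using rcvd_sent[OF assms(1)] less_Suc_eq_le by blast
  then show ?thesis using bl(2) network_mono sent_iff_network[OF assms(2)] by blast
qed

lemma witnesses_subset: "i \<in> correct \<Longrightarrow> witnesses (L t i) h \<subseteq> {..<n}"
  using local_inv[of i t] by (auto simp: local_inv_def witnesses_def)

lemma witnesses_mono:
  "i \<in> correct \<Longrightarrow> t \<le> t' \<Longrightarrow> witnesses (L t i) h \<subseteq> witnesses (L t' i) h"
  using local_mono(1)[of i t t'] by (auto simp: witnesses_def)

lemma card_witnesses_diff: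
  assumes "i \<in> correct"
  shows "card (witnesses (L t i) h) - card byz \<le> card (witnesses (L t i) h - byz)"
  using byz_subset by (intro diff_card_le_card_Diff) (auto intro: finite_subset)

lemma witnesses_diff_correct: "i \<in> correct \<Longrightarrow> witnesses (L t i) h - byz \<subseteq> correct"
  using witnesses_subset by (auto simp: correct_def)

lemma quorum_verified:
  assumes "i \<in> correct" "\<not> aborted (L t i)" "n - 2 * f \<le> card (witnesses (L t i) h)"
  shows "\<exists>c. verified i (L t i) h c"
proof -
  have "h \<in> checked (L t i)" "\<forall>h\<in>checked (L t i). \<exists>c. verified i (L t i) h c"
    using local_inv[OF assms(1), of t] assms(2,3) by (simp_all add: local_inv_def)
  then show ?thesis by blast
qed

lemma selection_card:
  assumes "i \<in> correct" "selection (L t i) h c"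
  shows "n - 2 * f \<le> card (witnesses (L t i) h)"
proof -
  have "card (dom c) \<le> card (witnesses (L t i) h)"
    using selection_witnesses[OF assms(2)] witnesses_subset[OF assms(1)]
    by (meson card_mono finite_lessThan finite_subset)
  then show ?thesis using assms(2) by (simp add: selection_def)
qed


section \<open>Only one root gathers a quorum\<close>

text \<open>The flag \<open>got_init\<close> does not remember the root, so acceptance is encoded as
  a timed event that carries the whole payload.\<close>

definition accepts :: "nat \<Rightarrow> nat \<Rightarrow> 'h \<Rightarrow> 'h list \<Rightarrow> 'b \<Rightarrow> bool" where
  "accepts t i h b l \<longleftrightarrow>
     (\<exists>d. a t = Receive sender i (Init h b l) d) \<and> \<not> aborted (L t i) \<and> \<not> got_init (L t i)"

definition init_replicas :: "nat \<Rightarrow> 'h \<Rightarrow> nat set" where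
  "init_replicas t h = {i \<in> correct. \<exists>t'<t. \<exists>b l. accepts t' i h b l}"

lemma accepts_step:
  assumes "accepts t i h b l"
  shows "i \<in> correct" "(sender, i, Init h b l) \<in> N t" "got_init (L (Suc t) i)"
    "(h, b, l) \<in> wit_sent (L (Suc t) i)"
proof -
  obtain d where d: "a t = Receive sender i (Init h b l) d"
    and s: "\<not> aborted (L t i)" "\<not> got_init (L t i)"
    using assms by (auto simp: accepts_def)
  obtain W where W: "i \<in> correct" "(sender, i, Init h b l) \<in> N t"
    "receive i (L t i) sender (Init h b l) (L (Suc t) i) W d"
    using received_step[OF d] .
  then show "i \<in> correct" "(sender, i, Init h b l) \<in> N t"
    "got_init (L (Suc t) i)" "(h, b, l) \<in> wit_sent (L (Suc t) i)"
    using receive_init_accepted[OF W(3) s(1)] s(2) by blast+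
qed

text \<open>Acceptance sets \<open>got_init\<close>, which is never reset, so it happens at one time
  only, and a single action fixes the payload.\<close>

lemma accepts_unique:
  assumes "accepts t i h b l" "accepts t' i h' b' l'"
  shows "h = h'"
proof -
  have "\<not> t < t'" if "accepts t i h b l" "accepts t' i h' b' l'" for t t' h h' b b' l l'
    using accepts_step[OF that(1)] that(2) local_mono(3)[of i "Suc t" t']
    by (auto simp: accepts_def)
  then have "t = t'" using assms by (meson linorder_neqE_nat)
  then show ?thesis using assms by (auto simp: accepts_def)
qed

lemma init_replicas_mono: "t \<le> t' \<Longrightarrow> init_replicas t h \<subseteq> init_replicas t' h"
  unfolding init_replicas_def using less_le_trans by blast

lemma finite_init_replicas: "finite (init_replicas t h)"
  using finite_correct by (simp add: init_replicas_def)

lemma card_init_replicas_mono: "t \<le> t' \<Longrightarrow> card (init_replicas t h) \<le> card (init_replicas t' h)"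
  by (intro card_mono finite_init_replicas init_replicas_mono)

text \<open>The premise \<open>sent\<close> is the induction hypothesis of \<open>sent_root\<close>,
  kept separate so that \<open>quorum_init\<close> can reuse the argument. If the count were too
  low, every correct member of the quorum would itself have accepted an init message for
  \<open>h\<close>, and these alone reach the bound.\<close>

lemma quorum_step:
  assumes sent: "\<And>j b l. j \<in> correct \<Longrightarrow> (h, b, l) \<in> wit_sent (L t j) \<Longrightarrow>
      j \<in> init_replicas t h \<or> n - 2 * f - card byz \<le> card (init_replicas t h)"
    and i: "i \<in> correct" and card: "n - 2 * f \<le> card (witnesses (L (Suc t) i) h)"
  shows "n - 2 * f - card byz \<le> card (init_replicas t h)"
proof (rule ccontr)
  assume low: "\<not> n - 2 * f - card byz \<le> card (init_replicas t h)"
  then have "witnesses (L (Suc t) i) h - byz \<subseteq> init_replicas t h"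
    using sent witness_sent[OF i] witnesses_diff_correct[OF i] by blast
  then have "card (witnesses (L (Suc t) i) h - byz) \<le> card (init_replicas t h)"
    by (intro card_mono finite_init_replicas)
  then show False
    using low card card_witnesses_diff[OF i, of "Suc t" h] by linarith
qed

text \<open>The first replica to send a witness message by interpolation has seen a quorum of replicas
  that were all prompted by an init message.\<close>

lemma sent_root:
  "\<lbrakk>i \<in> correct; (h, b, l) \<in> wit_sent (L t i)\<rbrakk> \<Longrightarrow>
   i \<in> init_replicas t h \<or> n - 2 * f - card byz \<le> card (init_replicas t h)"
proof (induction t arbitrary: i b l)
  case 0
  then show ?case by (simp add: initial_at initial_config_def initial_local_def)
next
  case (Suc t)
  have grow: "i \<in> init_replicas (Suc t) h \<or>
      n - 2 * f - card byz \<le> card (init_replicas (Suc t) h)"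
    if "i \<in> init_replicas t h \<or> n - 2 * f - card byz \<le> card (init_replicas t h)"
    using that init_replicas_mono[of t "Suc t" h] card_init_replicas_mono[of t "Suc t" h] by auto
  from Suc.prems(1) show ?case
  proof (cases rule: local_step_cases[of _ t])
    case (received j p W d)
    show ?thesis
    proof (cases "(h, b, l) \<in> wit_sent (L t i)")
      case True
      then show ?thesis using Suc grow by blast
    next
      case False
      then have "(h, b, l) \<in> W" using Suc.prems(2) receive_mono(5)[OF received(3)] by auto
      from receive_sent_origin[OF received(3) this] show ?thesis
      proof
        assume "p = Init h b l \<and> j = sender \<and> \<not> aborted (L t i) \<and> \<not> got_init (L t i)"
        then have "accepts t i h b l" using received by (auto simp: accepts_def)
        then show ?thesis using Suc.prems by (auto simp: init_replicas_def)
      next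
        assume "n - 2 * f \<le> card (witnesses (L (Suc t) i) h)"
        \<comment> \<open>All witnesses counted here were sent by time \<open>t\<close>, so the
          induction hypothesis covers them.\<close>
        then show ?thesis using quorum_step[of h t i] Suc grow by blast
      qed
    qed
  qed (use Suc grow in auto)
qed

lemma quorum_init:
  assumes "i \<in> correct" "n - 2 * f \<le> card (witnesses (L (Suc t) i) h)"
  shows "n - 2 * f - card byz \<le> card (init_replicas t h)"
  using quorum_step[of h t i] sent_root[of _ h _ _ t] assms by blast

lemma selection_quorum_init:
  assumes "i \<in> correct" "selection (L t i) h c"
  shows "n - 2 * f - card byz \<le> card (init_replicas t h)"
proof -
  \<comment> \<open>\<open>quorum_init\<close> speaks of the state after a step; the selection
    persists into it.\<close>
  have "selection (L (Suc t) i) h c"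
    using assms local_step_mono(1) selection_mono by blast
  then show ?thesis using quorum_init selection_card assms(1) by blast
qed

lemma selection_root_unique:
  assumes "i \<in> correct" "selection (L t i) h c" "i' \<in> correct" "selection (L t' i') h' c'"
  shows "h = h'"
proof (rule ccontr)
  assume "h \<noteq> h'"
  let ?T = "max t t'"
  have "init_replicas ?T h \<inter> init_replicas ?T h' = {}"
    using accepts_unique \<open>h \<noteq> h'\<close> by (fastforce simp: init_replicas_def)
  then have "card (init_replicas ?T h) + card (init_replicas ?T h')
      = card (init_replicas ?T h \<union> init_replicas ?T h')"
    by (simp add: card_Un_disjoint finite_init_replicas)
  also have "\<dots> \<le> card correct"
    by (intro card_mono finite_correct) (auto simp: init_replicas_def)
  finally have "card (init_replicas ?T h) + card (init_replicas ?T h') \<le> n - card byz"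
    by (simp add: card_correct)
  moreover have "n - 2 * f - card byz \<le> card (init_replicas ?T h)"
    using selection_quorum_init[OF assms(1,2)] card_init_replicas_mono[of t ?T h] by simp
  moreover have "n - 2 * f - card byz \<le> card (init_replicas ?T h')"
    using selection_quorum_init[OF assms(3,4)] card_init_replicas_mono[of t' ?T h'] by simp
  \<comment> \<open>With b = \<open>card byz\<close>, the bounds give 2 * (n - 2 * f - b) \<le> n -
    b, that is n \<le> 4 * f + b \<le> 5 * f. Rounding b up to f in the quorum bounds would break
    this whenever b < f.\<close>
  ultimately show False using resilience card_byz by linarith
qed


section \<open>Decoding\<close>

text \<open>Replica \<open>k\<close> has hashed the whole tree of \<open>enc m\<close> and
  \<open>i\<close> every path it received, so the binding property identifies each selected block
  with that of \<open>enc m\<close>.\<close>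

lemma decode_unique:
  assumes "length m = n - 2 * f" "k \<in> correct" "merkle_inputs H (enc m) \<subseteq> hashed (L t' k)"
    and i: "i \<in> correct" and sel: "selection (L t i) (merkle_root H (enc m)) c"
  shows "dec c = m"
proof -
  have len: "length (enc m) = n" using mds assms(1) by (simp add: mds_code_def)
  have dom: "dom c \<subseteq> {..<n}"
    using selection_witnesses[OF sel] witnesses_subset[OF i] by blast
  have block: "l = enc m ! j" if cj: "c j = Some l" for j l
  proof -
    obtain b where b: "(j, merkle_root H (enc m), b, l) \<in> wit_rcvd (L t i)"
      "branch_root H n j b l = Some (merkle_root H (enc m))"
      using sel cj by (auto simp: selection_def valid_branch_def)
    have "branch_inputs H n j b l \<subseteq> hashed (L t i)"
      using b(1) local_inv[OF i, of t] unfolding local_inv_def by blast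
    then have "inj_on H (branch_inputs H n j b l \<union> merkle_inputs H (enc m))"
      using assms(2,3) i
      by (intro inj_on_subset[OF no_collision[unfolded collision_free_def]]) blast
    then show ?thesis
      using branch_root_collision_free[OF b(2) len] dom cj by blast
  qed
  \<comment> \<open>This is the form of decoder argument for which \<open>mds_code\<close>
    guarantees recovery.\<close>
  have "c = (\<lambda>j. if j \<in> dom c then Some (enc m ! j) else None)"
    using block by (fastforce simp: fun_eq_iff dom_def)
  moreover have "card (dom c) = n - 2 * f" using sel by (simp add: selection_def)
  ultimately show ?thesis
    using mds assms(1) dom unfolding mds_code_def by metis
qed

text \<open>A settled message is the only one that any correct replica can ever decode.\<close>

definition settled :: "'b list \<Rightarrow> bool" where
  "settled m \<longleftrightarrow>
     length m = n - 2 * f \<and>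
     (\<exists>t. \<exists>k\<in>correct. merkle_inputs H (enc m) \<subseteq> hashed (L t k)) \<and>
     (\<forall>t. \<forall>i\<in>correct. \<forall>h c. selection (L t i) h c \<longrightarrow> h = merkle_root H (enc m))"

lemma settled_root:
  "\<lbrakk>settled m; i \<in> correct; selection (L t i) h c\<rbrakk> \<Longrightarrow> h = merkle_root H (enc m)"
  by (auto simp: settled_def)

lemma settled_decode:
  assumes "settled m" "i \<in> correct" "selection (L t i) h c"
  shows "dec c = m"
  using assms settled_root[OF assms] decode_unique unfolding settled_def by blast

text \<open>An abort leaves a refuted selection behind, but a selection can only decode to
  \<open>m\<close> under the root of \<open>enc m\<close>, which passes the check.\<close>

lemma settled_not_aborted:
  assumes "settled m" "i \<in> correct"
  shows "\<not> aborted (L t i)"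
proof
  assume "aborted (L t i)"
  then obtain h c where "refuted (L t i) h c"
    using local_inv[OF assms(2), of t] by (auto simp: local_inv_def)
  then show False
    using settled_root[OF assms] settled_decode[OF assms] by (auto simp: refuted_def)
qed

text \<open>Each witness arrives eventually and is recorded because \<open>i\<close> never aborts.
  As witness sets only grow, induction over the finite set \<open>S\<close> yields a common
  time.\<close>

lemma settled_witnesses:
  assumes "settled m" "S \<subseteq> correct" "i \<in> correct"
    and sent: "\<And>j. j \<in> S \<Longrightarrow> \<exists>t b l. (h, b, l) \<in> wit_sent (L t j) \<and> valid_branch H n h j b l"
  shows "\<exists>t. S \<subseteq> witnesses (L t i) h"
proof -
  have "finite S" using assms(2) finite_correct finite_subset by blast
  then show ?thesis using assms(2) sent
  proof (induction S)
    case empty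
    then show ?case by simp
  next
    case (insert j S)
    then obtain t1 where t1: "S \<subseteq> witnesses (L t1 i) h" by auto
    obtain t b l where bl: "(h, b, l) \<in> wit_sent (L t j)" "valid_branch H n h j b l"
      using insert.prems by blast
    have "(j, i, Witness h b l) \<in> N t"
      using bl assms(3) insert.prems by (simp add: sent_iff_network correct_def)
    then obtain t2 d where "a t2 = Receive j i (Witness h b l) d"
      using eventually_received assms(3) insert.prems by blast
    then obtain W where "receive i (L t2 i) j (Witness h b l) (L (Suc t2) i) W d"
      by (elim received_step)
    then have "(j, h, b, l) \<in> wit_rcvd (L (Suc t2) i)"
      by (rule receive_witness_recorded) (rule settled_not_aborted[OF assms(1,3)])
    then have "j \<in> witnesses (L (Suc t2) i) h"
      using bl(2) by (auto simp: witnesses_def)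
    then have "insert j S \<subseteq> witnesses (L (max t1 (Suc t2)) i) h"
      using t1 witnesses_mono[OF assms(3), of t1 "max t1 (Suc t2)" h]
        witnesses_mono[OF assms(3), of "Suc t2" "max t1 (Suc t2)" h] by auto
    then show ?case by blast
  qed
qed

text \<open>The selection is kept in the conclusion so that \<open>settled_decode\<close> can
  identify the delivered value; the two times need no relation for that.\<close>

lemma delivered_delivers:
  assumes "i \<in> correct" "h \<in> delivered (L t i)"
  shows "\<exists>t1 t2 c. selection (L t1 i) h c \<and> delivers a t2 i (dec c)"
  using assms(2)
proof (induction t)
  case 0
  then show ?case by (simp add: initial_at initial_config_def initial_local_def)
next
  case (Suc t)
  from assms(1) show ?case
  proof (cases rule: local_step_cases[of _ t])
    case (received j p W d)
    show ?thesis
    proof (cases "h \<in> delivered (L t i)")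
      case False
      then show ?thesis
        using receive_delivered[OF received(3) Suc.prems] received(1)
        unfolding delivers_def by blast
    qed (use Suc in auto)
  qed (use Suc in auto)
qed

text \<open>Two rounds: the witnesses from \<open>S\<close> bring every correct replica to
  \<open>n - 2 * f\<close>, so each sends a witness for its own block; these in turn bring
  \<open>i\<close> to \<open>n - f\<close>.\<close>

lemma settled_delivers:
  assumes m: "settled m" and "S \<subseteq> correct" "n - 2 * f \<le> card S"
    and sent: "\<And>j. j \<in> S \<Longrightarrow> \<exists>t b l. (merkle_root H (enc m), b, l) \<in> wit_sent (L t j) \<and>
      valid_branch H n (merkle_root H (enc m)) j b l"
    and i: "i \<in> correct"
  shows "\<exists>t. delivers a t i m"
proof -
  let ?h = "merkle_root H (enc m)"
  have len: "length (enc m) = n" using mds m by (simp add: mds_code_def settled_def)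
  have fin: "finite (witnesses (L t k) ?h)" if "k \<in> correct" for k t
    using witnesses_subset[OF that] finite_subset by blast
  have "\<exists>t b l. (?h, b, l) \<in> wit_sent (L t k) \<and> valid_branch H n ?h k b l"
    if k: "k \<in> correct" for k
  proof -
    obtain t where "S \<subseteq> witnesses (L t k) ?h"
      using settled_witnesses[OF m assms(2) k sent] by blast
    then have "n - 2 * f \<le> card (witnesses (L t k) ?h)"
      using assms(3) card_mono[OF fin[OF k]] le_trans by blast
    then obtain c where c: "verified k (L t k) ?h c"
      using quorum_verified[OF k settled_not_aborted[OF m k]] by blast
    then have "dec c = m"
      using settled_decode[OF m k] by (auto simp: verified_def)
    moreover have "valid_branch H n ?h k (merkle_branch H (enc m) k) (enc m ! k)"
      using branch_root_merkle_branch[OF len, of k H] k by (simp add: valid_branch_def correct_def)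
    ultimately show ?thesis using c by (auto simp: verified_def)
  qed
  then obtain t where "correct \<subseteq> witnesses (L t i) ?h"
    using settled_witnesses[OF m subset_refl i] by blast
  then have "card correct \<le> card (witnesses (L t i) ?h)"
    using card_mono[OF fin[OF i]] by blast
  then have "n - f \<le> card (witnesses (L t i) ?h)"
    using card_correct card_byz by linarith
  then have "?h \<in> delivered (L t i)"
    using local_inv[OF i, of t] settled_not_aborted[OF m i, of t] by (auto simp: local_inv_def)
  then show ?thesis
    using delivered_delivers[OF i] settled_decode[OF m i] by blast
qed


section \<open>Broadcast properties\<close>

lemma delivers_step:
  assumes "delivers a t p m"
  obtains h c where "p \<in> correct" "selection (L (Suc t) p) h c" "m = dec c"
    "h \<in> delivered (L (Suc t) p)" "h \<notin> delivered (L t p)" "\<not> aborted (L (Suc t) p)"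
    "n - f \<le> card (witnesses (L (Suc t) p) h)"
  using assms received_step receive_delivers unfolding delivers_def by metis

text \<open>At \<open>n - f\<close> witnesses the interpolation rule has also been executed, without
  abort. Its passed check supplies a codeword whose tree \<open>p\<close> has hashed, and
  \<open>selection_root_unique\<close> excludes other roots.\<close>

lemma delivers_settled:
  assumes "delivers a t p m"
  shows "settled m"
proof -
  obtain h c where p: "p \<in> correct" and c: "selection (L (Suc t) p) h c" "m = dec c"
    "\<not> aborted (L (Suc t) p)" "n - f \<le> card (witnesses (L (Suc t) p) h)"
    using delivers_step[OF assms] by metis
  from c(4) have "n - 2 * f \<le> card (witnesses (L (Suc t) p) h)" by linarith
  then obtain c' where c': "verified p (L (Suc t) p) h c'"
    using quorum_verified[OF p c(3)] by blast
  then have sel: "selection (L (Suc t) p) h c'" by (simp add: verified_def)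
  then have "dom c' \<subseteq> {..<n}" "card (dom c') = n - 2 * f"
    using selection_witnesses[OF sel] witnesses_subset[OF p] by (auto simp: selection_def)
  then have "length (dec c') = n - 2 * f"
    using mds by (simp add: mds_code_def)
  then have "settled (dec c')"
    using c' p selection_root_unique[OF _ _ p sel] by (auto simp: settled_def verified_def)
  \<comment> \<open>The selection \<open>c\<close> used for delivery may differ from the checked
    \<open>c'\<close>; settledness of \<open>dec c'\<close> makes both decode alike.\<close>
  then show ?thesis
    using settled_decode p c by metis
qed

text \<open>Each root is delivered at most once, and all selections in the execution share one
  root.\<close>

lemma delivers_unique:
  assumes "delivers a t p m" "delivers a t' p m"
  shows "t = t'"
proof -
  have "\<not> t < t'" if d: "delivers a t p m" "delivers a t' p m" for t t'
  proof
    assume "t < t'"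
    obtain h c where 1: "p \<in> correct" "selection (L (Suc t) p) h c" "h \<in> delivered (L (Suc t) p)"
      using delivers_step[OF d(1)] by metis
    obtain h' c' where 2: "selection (L (Suc t') p) h' c'" "h' \<notin> delivered (L t' p)"
      using delivers_step[OF d(2)] by metis
    have "h = h'" using selection_root_unique 1 2 by blast
    then show False
      using 1 2 local_mono(2)[of p "Suc t" t'] \<open>t < t'\<close> by auto
  qed
  then show ?thesis using assms by (meson linorder_neqE_nat)
qed

section \<open>Executions with a correct sender\<close>

lemma init_from_broadcast:
  assumes "sender \<in> correct" "(sender, i, Init h b l) \<in> N t"
  shows "\<exists>t'<t. \<exists>m. a t' = Broadcast m \<and> h = merkle_root H (enc m) \<and>
    b = merkle_branch H (enc m) i \<and> l = enc m ! i"
  using assms(2)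
proof (induction t)
  case 0
  then show ?case by (simp add: initial_at initial_config_def)
next
  case (Suc t)
  from Suc.prems show ?case
  proof (cases rule: network_step_cases)
    case old
    then show ?thesis using Suc.IH less_Suc_eq by blast
  \<comment> \<open>A correct sender is not in \<open>byz\<close>, so a Byzantine step cannot forge
    its init messages.\<close>
  qed (use assms(1) in \<open>auto simp: correct_def\<close>)
qed

lemma broadcast_unique:
  assumes "a t = Broadcast m" "a t' = Broadcast m'"
  shows "t = t'" "m = m'"
proof -
  have "\<not> t < t'" if "a t = Broadcast m" "a t' = Broadcast m'" for t t' m m'
    using broadcast_step[OF that(1)] broadcast_step(2)[OF that(2)]
      local_mono(4)[of sender "Suc t" t'] by auto
  then show "t = t'" using assms by (meson linorder_neqE_nat)
  then show "m = m'" using assms by simp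
qed

text \<open>Behind a quorum stand at least n - 3 * f \<ge> 2 * f + 1 accepted init messages; a
  single one suffices to trace the root back to an input of the sender.\<close>

lemma quorum_broadcast:
  assumes "sender \<in> correct" "i \<in> correct" "n - 2 * f \<le> card (witnesses (L (Suc t) i) h)"
  shows "\<exists>t'<t. \<exists>m. a t' = Broadcast m \<and> h = merkle_root H (enc m)"
proof -
  have "0 < card (init_replicas t h)"
    using quorum_init[OF assms(2,3)] resilience card_byz by linarith
  then obtain k where "k \<in> init_replicas t h" by (metis card_gt_0_iff ex_in_conv)
  then obtain t' b l where t': "t' < t" "accepts t' k h b l" by (auto simp: init_replicas_def)
  obtain t'' m where "t'' < t'" "a t'' = Broadcast m" "h = merkle_root H (enc m)"
    using init_from_broadcast[OF assms(1) accepts_step(2)[OF t'(2)]] by blast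
  then show ?thesis using t'(1) less_trans by blast
qed

lemma delivers_broadcast:
  assumes "sender \<in> correct" "delivers a t p m"
  shows "\<exists>t'<t. a t' = Broadcast m"
proof -
  obtain h c where p: "p \<in> correct" and c: "selection (L (Suc t) p) h c" "m = dec c"
    using delivers_step[OF assms(2)] by metis
  then obtain t' m' where m': "t' < t" "a t' = Broadcast m'" "h = merkle_root H (enc m')"
    using quorum_broadcast[OF assms(1) p] selection_card by blast
  have "dec c = m'"
    using decode_unique[OF broadcast_step(4)[OF m'(2)] assms(1) broadcast_step(5)[OF m'(2)] p] c m'
    by blast
  then show ?thesis using c m' by blast
qed

text \<open>The sender takes one input only, so every quorum root is traced back to this same
  broadcast.\<close>

lemma broadcast_settled:
  assumes "a t = Broadcast m"
  shows "settled m"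
proof -
  have "h = merkle_root H (enc m)" if "i \<in> correct" "selection (L t' i) h c" for i t' h c
  proof -
    have "selection (L (Suc t') i) h c"
      using that local_step_mono(1) selection_mono by blast
    then have "n - 2 * f \<le> card (witnesses (L (Suc t') i) h)"
      using selection_card that by blast
    then show ?thesis
      using quorum_broadcast broadcast_step(1)[OF assms] that broadcast_unique(2)[OF assms]
      by blast
  qed
  then show ?thesis
    using broadcast_step[OF assms] unfolding settled_def by blast
qed

lemma got_init_accepts:
  assumes "i \<in> correct" "got_init (L t i)"
  shows "\<exists>t' h b l. accepts t' i h b l"
  using assms(2)
proof (induction t)
  case 0
  then show ?case by (simp add: initial_at initial_config_def initial_local_def)
next
  case (Suc t)
  from assms(1) show ?case
  proof (cases rule: local_step_cases[of _ t])
    case (received j p W d)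
    show ?thesis
    proof (cases "got_init (L t i)")
      case False
      then show ?thesis
        using receive_got_init[OF received(3) Suc.prems] received(1)
        unfolding accepts_def by blast
    qed (use Suc in auto)
  qed (use Suc in auto)
qed

lemma broadcast_witnessed:
  assumes "a t = Broadcast m" "j \<in> correct"
  shows "\<exists>t' b l. (merkle_root H (enc m), b, l) \<in> wit_sent (L t' j) \<and>
      valid_branch H n (merkle_root H (enc m)) j b l"
proof -
  let ?p = "Init (merkle_root H (enc m)) (merkle_branch H (enc m) j) (enc m ! j)"
  have j: "j < n" using assms(2) by (simp add: correct_def)
  have len: "length (enc m) = n"
    using mds broadcast_step(4)[OF assms(1)] by (simp add: mds_code_def)
  note sender = broadcast_step(1)[OF assms(1)]
  obtain t1 d where "a t1 = Receive sender j ?p d"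
    using eventually_received[OF sender assms(2) broadcast_step(6)[OF assms(1) j]] by blast
  then obtain W where "receive j (L t1 j) sender ?p (L (Suc t1) j) W d"
    by (elim received_step)
  \<comment> \<open>The init message received at \<open>t1\<close> may be a duplicate of one
    accepted earlier. The flag yields some acceptance, whose payload is then traced to the only
    broadcast.\<close>
  then have "got_init (L (Suc t1) j)"
    by (rule receive_init_accepted)
      (rule settled_not_aborted[OF broadcast_settled[OF assms(1)] assms(2)])
  then obtain t2 h b l where acc: "accepts t2 j h b l"
    using got_init_accepts[OF assms(2)] by blast
  then obtain t3 m' where "a t3 = Broadcast m'" "h = merkle_root H (enc m')"
    "b = merkle_branch H (enc m') j" "l = enc m' ! j"
    using init_from_broadcast[OF sender accepts_step(2)] by blast
  then have "h = merkle_root H (enc m)" "b = merkle_branch H (enc m) j" "l = enc m ! j"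
    using broadcast_unique(2)[OF assms(1)] by auto
  then show ?thesis
    using accepts_step(4)[OF acc] branch_root_merkle_branch[OF len j]
    unfolding valid_branch_def by blast
qed

lemma validity:
  assumes "a t = Broadcast m"
  shows "\<exists>t'\<ge>t. delivers a t' sender m"
proof -
  have "n - 2 * f \<le> card correct"
    using card_correct card_byz by linarith
  then obtain t' where t': "delivers a t' sender m"
    using settled_delivers[OF broadcast_settled[OF assms] subset_refl _
        broadcast_witnessed[OF assms] broadcast_step(1)[OF assms]] by blast
  \<comment> \<open>The delivery must be shown not to precede step \<open>t\<close>: some broadcast
    precedes it, and by uniqueness that is the one at \<open>t\<close>.\<close>
  then obtain t'' where "t'' < t'" "a t'' = Broadcast m"
    using delivers_broadcast[OF broadcast_step(1)[OF assms]] by blast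
  then show ?thesis
    using broadcast_unique(1)[OF assms] t' less_imp_le by blast
qed

lemma agreement:
  assumes "delivers a t p m" "q \<in> correct"
  shows "\<exists>t'. delivers a t' q m"
proof -
  obtain h c where p: "p \<in> correct" and c: "selection (L (Suc t) p) h c"
    "n - f \<le> card (witnesses (L (Suc t) p) h)"
    using delivers_step[OF assms(1)] by metis
  have m: "settled m" by (rule delivers_settled[OF assms(1)])
  have h: "h = merkle_root H (enc m)" by (rule settled_root[OF m p c(1)])
  let ?S = "witnesses (L (Suc t) p) h - byz"
  \<comment> \<open>The gap of \<open>f\<close> between the thresholds absorbs the Byzantine
    witnesses: enough correct ones remain to start the first round at every correct replica.\<close>
  have "n - 2 * f \<le> card ?S"
    using card_witnesses_diff[OF p, of "Suc t" h] c(2) card_byz by linarith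
  moreover have "?S \<subseteq> correct" by (rule witnesses_diff_correct[OF p])
  ultimately show ?thesis
    using settled_delivers[OF m _ _ _ assms(2), of ?S] witness_sent[OF p] h by blast
qed

lemma reliable: "reliable_broadcast correct sender (broadcasts a) (delivers a)"
proof -
  have "rb_validity correct (broadcasts a) (delivers a)"
    using validity by (auto simp: rb_validity_def broadcasts_def)
  moreover have "rb_agreement correct (delivers a)"
    using agreement by (auto simp: rb_agreement_def)
  moreover have "rb_integrity correct sender (broadcasts a) (delivers a)"
    using delivers_unique delivers_broadcast
    by (auto simp: rb_integrity_def broadcasts_def)
  ultimately show ?thesis by (simp add: reliable_broadcast_def)
qed

end

theorem theorem1:
  fixes n f sender :: nat
    and byz :: "nat set"
    and H :: "('b, 'h) hash_input \<Rightarrow> 'h"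
    and enc :: "'b list \<Rightarrow> 'b list"
    and dec :: "(nat \<Rightarrow> 'b option) \<Rightarrow> 'b list"
    and C :: "nat \<Rightarrow> ('b, 'h) config"
    and a :: "nat \<Rightarrow> ('b, 'h) action"
  assumes "n \<ge> 5 * f + 1"
    and "sender < n"
    and "byz \<subseteq> {..<n}" and "card byz \<le> f"
    and "mds_code (n - 2 * f) n enc dec"
    and "mbc.execution n f sender byz H enc dec C a"
    and "mbc.collision_free n byz H C"
  shows "reliable_broadcast (mbc.correct n byz) sender (mbc.broadcasts sender a) (mbc.delivers a)"
proof -
  interpret mbc_run n f sender byz H enc dec C a
    by unfold_locales (use assms in auto)
  show ?thesis by (rule reliable)
qed

end
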